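(* Let $\Pi$ be a planning task and $\mathcal A$ a set of abstractions for $\Pi$. For every state $s$ of $\Pi$, let $h^{\mathrm{pot}}_{\mathcal F_{\mathcal A},\max s}$ be an admissible and consistent potential heuristic over the features $\mathcal F_{\mathcal A}$ with maximal value for $s$ (among all admissible and consistent potential heuristics over $\mathcal F_{\mathcal A}$). Then $$h^{\mathrm{pot}}_{\mathcal F_{\mathcal A},\max s}(s)=h^{\mathrm{TCP}}_{\mathcal A}(s),$$ where $h^{\mathrm{TCP}}_{\mathcal A}$ is the optimal transition cost partitioning heuristic for the abstraction heuristics of the abstractions in $\mathcal A$.
   Context: Planning tasks. A planning task (in transition normal form) is $\Pi=\langle\mathcal V,\mathcal O,s_I,s_\star\rangle$. $\mathcal V$ is a finite set of variables, each with a finite domain. A partial variable assignment maps a subset of $\mathcal V$ to values in the respective domains; a state is an assignment defined on all of $\mathcal V$; $\mathcal S$ is the set of all states. $s_I$ (initial state) and $s_\star$ (the unique goal state) are states. $\mathcal O$ is a finite set of operators; each $o$ has a precondition $\mathrm{pre}(o)$ and an effect $\mathrm{eff}(o)$, both partial variable assignments defined on the same set $\mathrm{vars}(o)$ of variables, and a cost $\mathrm{cost}(o)$, a non-negative integer. Operator $o$ is applicable in state $s$ if $s$ agrees with $\mathrm{pre}(o)$ on $\mathrm{vars}(o)$; applying it gives the state that agrees with $\mathrm{eff}(o)$ on $\mathrm{vars}(o)$ and with $s$ elsewhere. $\mathcal T$ is the set of all transitions $s\xrightarrow{o}s'$ with $s\in\mathcal S$, $o\in\mathcal O$ applicable in $s$,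 and $s'$ the result of applying $o$ in $s$. An $s$-plan is a finite sequence of operators successively applicable starting from $s$ and leading to $s_\star$; its cost is the sum of its operator costs; $h^*(s)$ is the minimal cost of an $s$-plan ($\infty$ if there is none). A heuristic maps states to $\mathbb R\cup\{-\infty,\infty\}$. A heuristic $h$ is admissible if $h(s)\le h^*(s)$ for all $s\in\mathcal S$, and consistent if $h(s)\le\mathrm{cost}(o)+h(s')$ for all $s\xrightarrow{o}s'\in\mathcal T$. Abstractions. An abstraction of $\Pi$ is a homomorphic mapping $\alpha:\mathcal S\to\mathcal S^\alpha$ to the abstract states of an abstract transition system with initial state $\alpha(s_I)$, goal state $\alpha(s_\star)$, and containing for every $s\xrightarrow{o}s'\in\mathcal T$ the transition $\alpha(s)\xrightarrow{o}\alpha(s')$ with the same weight. Abstract states are uniquely named, i.e. the sets $\mathcal S^\alpha$, $\alpha\in\mathcal A$, are pairwise disjoint. Potential heuristics over $\mathcal F_{\mathcal A}$. The feature set is $\mathcal F_{\mathcal A}=\bigcup_{\alpha\in\mathcal A}\mathcal S^\alpha$, where a state $s$ has the feature $t\in\mathcal S^\alpha$ iff $\alpha(s)=t$. For a weight function $w:\mathcal F_{\mathcal A}\to\mathbb R$ the corresponding potential heuristic is $\varphi(s)=\sum_{f\in\mathcal F_{\mathcal A}}w(f)\,[s\text{ has feature }f]$, where the bracket is $1$ if the condition holds and $0$ otherwise. Optimal transition cost partitioning. A transition cost partitioning is a tuple $P=\langle\mathrm{cost}_1,\dots,\mathrm{cost}_n\rangle$ of functions $\mathrm{cost}_i:\mathcal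 T\to\mathbb R$ (negative values allowed) such that $\sum_{i=1}^n\mathrm{cost}_i(s\xrightarrow{o}s')\le\mathrm{cost}(o)$ for all $s\xrightarrow{o}s'\in\mathcal T$. Given admissible heuristics $h_1,\dots,h_n$, where $h_i(s,\mathrm{cost}_i)$ denotes the value of $h_i$ at $s$ when costs are given by the transition cost function $\mathrm{cost}_i$, let $h_P(s)=\sum_{i=1}^n h_i(s,\mathrm{cost}_i)$. The optimal transition cost partitioning heuristic is $h^{\mathrm{TCP}}(s)=\max_{P\in\mathcal P}h_P(s)$, where $\mathcal P$ is the set of all transition cost partitionings. $h^{\mathrm{TCP}}_{\mathcal A}$ is this heuristic when $\mathcal A=\{\alpha_1,\dots,\alpha_n\}$ and $h_i$ is the abstraction heuristic of $\alpha_i$: $h_i(s,\mathrm{cost}_i)$ is the goal distance of the abstract state $\alpha_i(s)$, i.e. the cost of a cheapest path from $\alpha_i(s)$ to $\alpha_i(s_\star)$ in the abstract transition system whose transitions $\alpha_i(r)\xrightarrow{o}\alpha_i(r')$, one for each $r\xrightarrow{o}r'\in\mathcal T$, are weighted by $\mathrm{cost}_i(r\xrightarrow{o}r')$. Cheapest costs may be negative, or $-\infty$ in the case of negative-cost cycles.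
   Formalization: The goal distance of an abstract state that can reach the goal is taken to be −∞ if any negative-cost cycle exists anywhere in the abstract transition system, not only on paths from that state to the goal; with plain cheapest-path costs the equality can fail. *)

theory Defs
  imports Complex_Main "HOL-Library.Extended_Real" "HOL-Library.Disjoint_Sets"
    "HOL-Analysis.Infinite_Sum"
begin

section \<open>Planning tasks in transition normal form\<close>

type_synonym ('v, 'd) assignment = "'v \<rightharpoonup> 'd"

record ('v, 'd, 'o) task =
  variables :: "'v set"
  domain_of :: "'v \<Rightarrow> 'd set"
  operators :: "'o set"
  pre :: "'o \<Rightarrow> ('v, 'd) assignment"
  eff :: "'o \<Rightarrow> ('v, 'd) assignment"
  cost :: "'o \<Rightarrow> nat"
  init_state :: "('v, 'd) assignment"
  goal_state :: "('v, 'd) assignment"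

definition partial_assignment :: "('v, 'd, 'o) task \<Rightarrow> ('v, 'd) assignment \<Rightarrow> bool" where
  "partial_assignment T a \<longleftrightarrow>
     dom a \<subseteq> variables T \<and> (\<forall>v x. a v = Some x \<longrightarrow> x \<in> domain_of T v)"

definition states :: "('v, 'd, 'o) task \<Rightarrow> ('v, 'd) assignment set" where
  "states T = {s. partial_assignment T s \<and> dom s = variables T}"

definition planning_task :: "('v, 'd, 'o) task \<Rightarrow> bool" where
  "planning_task T \<longleftrightarrow>
     finite (variables T) \<and> (\<forall>v\<in>variables T. finite (domain_of T v)) \<and>
     finite (operators T) \<and>
     (\<forall>a\<in>operators T. partial_assignment T (pre T a) \<and> partial_assignment T (eff T a) \<and>
        dom (pre T a) = dom (eff T a)) \<and>
     init_state T \<in> states T \<and> goal_state T \<in> states T"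

definition applicable :: "('v, 'd, 'o) task \<Rightarrow> 'o \<Rightarrow> ('v, 'd) assignment \<Rightarrow> bool" where
  "applicable T a s \<longleftrightarrow> pre T a \<subseteq>\<^sub>m s"

definition result :: "('v, 'd, 'o) task \<Rightarrow> 'o \<Rightarrow> ('v, 'd) assignment \<Rightarrow> ('v, 'd) assignment" where
  "result T a s = s ++ eff T a"

type_synonym ('v, 'd, 'o) transition = "('v, 'd) assignment \<times> 'o \<times> ('v, 'd) assignment"

definition transitions :: "('v, 'd, 'o) task \<Rightarrow> ('v, 'd, 'o) transition set" where
  "transitions T = {(s, a, s'). s \<in> states T \<and> a \<in> operators T \<and> applicable T a s \<and>
     s' = result T a s}"

fun is_plan :: "('v, 'd, 'o) task \<Rightarrow> ('v, 'd) assignment \<Rightarrow> 'o list \<Rightarrow> bool" where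
  "is_plan T s [] \<longleftrightarrow> s = goal_state T"
| "is_plan T s (a # as) \<longleftrightarrow>
     a \<in> operators T \<and> applicable T a s \<and> is_plan T (result T a s) as"

definition plan_cost :: "('v, 'd, 'o) task \<Rightarrow> 'o list \<Rightarrow> nat" where
  "plan_cost T as = sum_list (map (cost T) as)"

text \<open>The infimum over the empty set of plans is \<open>\<infinity>\<close>; otherwise it is a minimum, because
  plan costs are natural numbers.\<close>

definition hstar :: "('v, 'd, 'o) task \<Rightarrow> ('v, 'd) assignment \<Rightarrow> ereal" where
  "hstar T s = (INF as\<in>{as. is_plan T s as}. ereal (real (plan_cost T as)))"

type_synonym ('v, 'd) heuristic = "('v, 'd) assignment \<Rightarrow> ereal"

definition admissible :: "('v, 'd, 'o) task \<Rightarrow> ('v, 'd) heuristic \<Rightarrow> bool" where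
  "admissible T h \<longleftrightarrow> (\<forall>s\<in>states T. h s \<le> hstar T s)"

definition consistent :: "('v, 'd, 'o) task \<Rightarrow> ('v, 'd) heuristic \<Rightarrow> bool" where
  "consistent T h \<longleftrightarrow>
     (\<forall>(s, a, s')\<in>transitions T. h s \<le> ereal (real (cost T a)) + h s')"


section \<open>Abstractions\<close>

text \<open>Edges carry a label of type \<open>'e\<close>, so parallel edges are possible.\<close>

record ('t, 'e) transition_system =
  ts_init :: 't
  ts_goal :: 't
  ts_edges :: "('t \<times> 'e \<times> 't) set"

record ('v, 'd, 't) abstraction =
  abs_states :: "'t set"
  abs_map :: "('v, 'd) assignment \<Rightarrow> 't"

definition is_abstraction :: "('v, 'd, 'o) task \<Rightarrow> ('v, 'd, 't) abstraction \<Rightarrow> bool" where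
  "is_abstraction T \<alpha> \<longleftrightarrow> abs_map \<alpha> \<in> states T \<rightarrow> abs_states \<alpha>"

text \<open>The map is a homomorphism into this system by construction. An abstract edge is labelled
  with the concrete transition that induces it, because a transition cost function may give
  different weights to transitions with the same operator and the same abstract end points.\<close>

definition abstract_system ::
  "('v, 'd, 'o) task \<Rightarrow> ('v, 'd, 't) abstraction \<Rightarrow>
     ('t, ('v, 'd, 'o) transition) transition_system" where
  "abstract_system T \<alpha> =
     \<lparr> ts_init = abs_map \<alpha> (init_state T),
       ts_goal = abs_map \<alpha> (goal_state T),
       ts_edges = {(abs_map \<alpha> r, (r, a, r'), abs_map \<alpha> r') | r a r'.
         (r, a, r') \<in> transitions T} \<rparr>"

definition abstraction_collection ::
  "('v, 'd, 'o) task \<Rightarrow> ('v, 'd, 't) abstraction set \<Rightarrow> bool" where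
  "abstraction_collection T A \<longleftrightarrow>
     finite A \<and> (\<forall>\<alpha>\<in>A. is_abstraction T \<alpha>) \<and> disjoint_family_on abs_states A"


section \<open>Potential heuristics\<close>

definition features :: "('v, 'd, 't) abstraction set \<Rightarrow> 't set" where
  "features A = (\<Union>\<alpha>\<in>A. abs_states \<alpha>)"

definition has_feature ::
  "('v, 'd, 't) abstraction set \<Rightarrow> ('v, 'd) assignment \<Rightarrow> 't \<Rightarrow> bool" where
  "has_feature A s t \<longleftrightarrow> (\<exists>\<alpha>\<in>A. t \<in> abs_states \<alpha> \<and> abs_map \<alpha> s = t)"

text \<open>Sets of abstract states are not required to be finite, hence the infinite sum; it has at
  most \<open>card A\<close> nonzero summands.\<close>

definition potential ::
  "('v, 'd, 't) abstraction set \<Rightarrow> ('t \<Rightarrow> real) \<Rightarrow> ('v, 'd) assignment \<Rightarrow> real" where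
  "potential A w s = (\<Sum>\<^sub>\<infinity>f\<in>features A. w f * of_bool (has_feature A s f))"

definition potential_heuristic ::
  "('v, 'd, 'o) task \<Rightarrow> ('v, 'd, 't) abstraction set \<Rightarrow> ('v, 'd) heuristic \<Rightarrow> bool" where
  "potential_heuristic T A h \<longleftrightarrow> (\<exists>w. \<forall>s\<in>states T. h s = ereal (potential A w s))"

definition max_potential_heuristic ::
  "('v, 'd, 'o) task \<Rightarrow> ('v, 'd, 't) abstraction set \<Rightarrow> ('v, 'd) assignment \<Rightarrow>
     ('v, 'd) heuristic \<Rightarrow> bool" where
  "max_potential_heuristic T A s h \<longleftrightarrow>
     potential_heuristic T A h \<and> admissible T h \<and> consistent T h \<and>
     (\<forall>h'. potential_heuristic T A h' \<and> admissible T h' \<and> consistent T h' \<longrightarrow> h' s \<le> h s)"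


section \<open>Optimal transition cost partitioning\<close>

fun is_path :: "('t, 'e) transition_system \<Rightarrow> 't \<Rightarrow> ('t \<times> 'e \<times> 't) list \<Rightarrow> 't \<Rightarrow> bool" where
  "is_path G t [] u \<longleftrightarrow> t = u"
| "is_path G t ((x, e, y) # p) u \<longleftrightarrow> (x, e, y) \<in> ts_edges G \<and> x = t \<and> is_path G y p u"

definition path_cost :: "('e \<Rightarrow> real) \<Rightarrow> ('t \<times> 'e \<times> 't) list \<Rightarrow> real" where
  "path_cost c p = sum_list (map (\<lambda>(x, e, y). c e) p)"

definition has_negative_cycle :: "('t, 'e) transition_system \<Rightarrow> ('e \<Rightarrow> real) \<Rightarrow> bool" where
  "has_negative_cycle G c \<longleftrightarrow> (\<exists>t p. is_path G t p t \<and> path_cost c p < 0)"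

text \<open>The value is \<open>\<infinity>\<close> if there is no path to the goal. If there is one, a negative-cost cycle
  \<^emph>\<open>anywhere\<close> in the system makes the value \<open>-\<infinity>\<close>, even if no path from \<open>t\<close> to the goal
  meets the cycle; this is the convention under which finite abstract distances satisfy the usual
  linear program, with one constraint for every transition of the system. With the bare infimum,
  making transitions on irrelevant cycles arbitrarily cheap in one abstraction would make them
  arbitrarily expensive in the others, and the resulting cost partitioning could exceed every
  consistent potential heuristic. Without negative-cost cycles the infimum is a minimum in a
  finite system.\<close>

definition goal_distance :: "('t, 'e) transition_system \<Rightarrow> ('e \<Rightarrow> real) \<Rightarrow> 't \<Rightarrow> ereal" where
  "goal_distance G c t =
     (if (\<exists>p. is_path G t p (ts_goal G)) \<and> has_negative_cycle G c then -\<infinity>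
      else INF p\<in>{p. is_path G t p (ts_goal G)}. ereal (path_cost c p))"

definition abstraction_heuristic ::
  "('v, 'd, 'o) task \<Rightarrow> ('v, 'd, 't) abstraction \<Rightarrow> (('v, 'd, 'o) transition \<Rightarrow> real) \<Rightarrow>
     ('v, 'd) heuristic" where
  "abstraction_heuristic T \<alpha> c s = goal_distance (abstract_system T \<alpha>) c (abs_map \<alpha> s)"

text \<open>A cost partitioning is indexed by the abstractions themselves. Only its values on
  \<open>A\<close> and \<open>transitions T\<close> matter.\<close>

definition cost_partitionings ::
  "('v, 'd, 'o) task \<Rightarrow> ('v, 'd, 't) abstraction set \<Rightarrow>
     (('v, 'd, 't) abstraction \<Rightarrow> ('v, 'd, 'o) transition \<Rightarrow> real) set" where
  "cost_partitionings T A =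
     {P. \<forall>(s, a, s')\<in>transitions T. (\<Sum>\<alpha>\<in>A. P \<alpha> (s, a, s')) \<le> real (cost T a)}"

definition h_partitioning ::
  "('v, 'd, 'o) task \<Rightarrow> ('v, 'd, 't) abstraction set \<Rightarrow>
     (('v, 'd, 't) abstraction \<Rightarrow> ('v, 'd, 'o) transition \<Rightarrow> real) \<Rightarrow> ('v, 'd) heuristic" where
  "h_partitioning T A P s = (\<Sum>\<alpha>\<in>A. abstraction_heuristic T \<alpha> (P \<alpha>) s)"

definition h_TCP ::
  "('v, 'd, 'o) task \<Rightarrow> ('v, 'd, 't) abstraction set \<Rightarrow> ('v, 'd) heuristic" where
  "h_TCP T A s = (SUP P\<in>cost_partitionings T A. h_partitioning T A P s)"

end

(* A potential heuristic splits as a sum over the abstractions of weights of abstract states.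
   Consistent weights w induce the partitioning w (\<alpha> r) - w (\<alpha> r'), under which every abstract
   path telescopes; this shows that TCP dominates. Conversely, a partitioning without negative
   cycles yields shortest-path weights which satisfy one constraint per abstract edge, and summing
   these constraints gives consistency. Abstract states that cannot reach the goal need
   care: if the state s is mapped to one, all such weights can be raised together, which
   contradicts maximality. *)

theory Submission
  imports Defs
begin

section \<open>Paths in transition systems\<close>

lemma is_path_append:
  "is_path G t (p @ q) u \<longleftrightarrow> (\<exists>v. is_path G t p v \<and> is_path G v q u)"
  by (induction G t p u rule: is_path.induct) auto

lemma path_cost_Nil [simp]: "path_cost c [] = 0"
  by (simp add: path_cost_def)

lemma path_cost_Cons [simp]: "path_cost c ((x, e, y) # p) = c e + path_cost c p"
  by (simp add: path_cost_def)

lemma path_cost_append [simp]: "path_cost c (p @ q) = path_cost c p + path_cost c q"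
  by (simp add: path_cost_def)

lemma is_path_edges: "is_path G t p u \<Longrightarrow> set p \<subseteq> ts_edges G"
  by (induction G t p u rule: is_path.induct) auto

lemma path_cost_telescope:
  assumes "\<And>x e y. (x, e, y) \<in> ts_edges G \<Longrightarrow> c e = w x - w y" and "is_path G t p u"
  shows "path_cost c p = w t - w u"
  using assms(2,1) by (induction G t p u rule: is_path.induct) auto

section \<open>Shortest paths without negative cycles\<close>

text \<open>Cutting out a closed subpath never raises the cost, so only paths without repeated edges
  matter, and these cost at least minus the total absolute weight. The bound is uniform in the path,
  so infima over paths cannot be \<open>-\<infinity>\<close>.\<close>

lemma path_cost_lower_bound:
  assumes fin: "finite (ts_edges G)" and nc: "\<not> has_negative_cycle G c" and "is_path G t p u"
  shows "- (\<Sum>(x, e, y)\<in>ts_edges G. \<bar>c e\<bar>) \<le> path_cost c p"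
  using assms(3)
proof (induction p rule: length_induct)
  case (1 p)
  show ?case
  proof (cases "distinct p")
    case True
    have "path_cost c p = (\<Sum>(x, e, y)\<in>set p. c e)"
      using True by (simp add: path_cost_def sum_list_distinct_conv_sum_set)
    moreover have "(\<Sum>(x, e, y)\<in>set p. - c e) \<le> (\<Sum>(x, e, y)\<in>set p. \<bar>c e\<bar>)"
      by (intro sum_mono) auto
    moreover have "(\<Sum>(x, e, y)\<in>set p. \<bar>c e\<bar>) \<le> (\<Sum>(x, e, y)\<in>ts_edges G. \<bar>c e\<bar>)"
      using is_path_edges[OF 1(2)] fin by (intro sum_mono2) auto
    moreover have "(\<Sum>(x, e, y)\<in>set p. - c e) = - (\<Sum>(x, e, y)\<in>set p. c e)"
      by (simp add: split_def sum_negf)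
    ultimately show ?thesis by linarith
  next
    case False
    \<comment> \<open>From the first occurrence of \<open>d\<close> up to the second,
      \<open>[d] @ ys\<close> is a closed path, hence of nonnegative cost; deleting it leaves a
      shorter path with the same end points.\<close>
    then obtain xs ys zs d where p: "p = xs @ [d] @ ys @ [d] @ zs"
      using not_distinct_decomp by blast
    obtain x e y where d: "d = (x, e, y)" by (cases d)
    from 1(2) have "is_path G t (xs @ [d] @ zs) u" and "is_path G x ([d] @ ys) x"
      by (auto simp: p d is_path_append)
    then have "- (\<Sum>(x, e, y)\<in>ts_edges G. \<bar>c e\<bar>) \<le> path_cost c (xs @ [d] @ zs)"
      and "0 \<le> path_cost c ([d] @ ys)"
      using 1(1) nc by (auto simp: p has_negative_cycle_def not_less simp del: path_cost_append)
    then show ?thesis by (simp add: p d)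
  qed
qed

lemma goal_distance_le:
  assumes "is_path G t p (ts_goal G)"
  shows "goal_distance G c t \<le> ereal (path_cost c p)"
  using assms by (auto simp: goal_distance_def intro: INF_lower)

text \<open>Every closed path costs 0, which rules out the negative-cycle branch, and every path to
  the goal costs exactly \<open>w t - w (ts_goal G)\<close>. The inequality is strict only when no
  such path exists and the distance is \<infinity>.\<close>

lemma goal_distance_telescope:
  assumes c: "\<And>x e y. (x, e, y) \<in> ts_edges G \<Longrightarrow> c e = w x - w y"
  shows "ereal (w t - w (ts_goal G)) \<le> goal_distance G c t"
proof -
  note tel = path_cost_telescope[of G c w, OF c]
  have "\<not> has_negative_cycle G c"
    using tel by (fastforce simp: has_negative_cycle_def)
  then show ?thesis
    using tel by (auto simp: goal_distance_def intro!: INF_greatest)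
qed

text \<open>Paths may end anywhere, at the price of a penalty \<open>M\<close> if they miss the goal: this keeps
  the shortest-path weights finite on states that cannot reach the goal. A large penalty does not
  affect the weight of \<open>t\<close>.\<close>

lemma shortest_path_weights:
  assumes fin: "finite (ts_edges G)" and nc: "\<not> has_negative_cycle G c"
    and p0: "is_path G t p0 (ts_goal G)"
  obtains w where "\<And>x e y. (x, e, y) \<in> ts_edges G \<Longrightarrow> w x \<le> c e + w y"
    and "w (ts_goal G) \<le> 0" and "goal_distance G c t \<le> ereal (w t)"
proof -
  define B where "B = (\<Sum>(x, e, y)\<in>ts_edges G. \<bar>c e\<bar>)"
  \<comment> \<open>A path from \<open>t\<close> that misses the goal costs at least
    \<open>- B\<close>, so with this penalty it is no cheaper than \<open>p0\<close>.\<close>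
  define M where "M = path_cost c p0 + B"
  define pen where "pen = (\<lambda>u. if u = ts_goal G then 0 else M)"
  define K where "K = (\<lambda>x. {path_cost c p + pen u | p u. is_path G x p u})"
  define w where "w = (\<lambda>x. Inf (K x))"
  have B: "- B \<le> path_cost c p" if "is_path G x p u" for x p u
    using path_cost_lower_bound[OF fin nc that] by (simp add: B_def)
  \<comment> \<open>The real \<open>Inf\<close> is meaningful only for nonempty sets bounded below.
    This gives the bound, with \<open>min 0 M\<close> covering both values of the penalty;
    nonemptiness comes from the empty path in \<open>self\<close>.\<close>
  have "- B + min 0 M \<le> k" if "k \<in> K x" for x k
  proof -
    from that obtain p u where "is_path G x p u" and k: "k = path_cost c p + pen u"
      by (auto simp: K_def)
    then show ?thesis using B[of x p u] by (auto simp: pen_def)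
  qed
  then have bdd: "bdd_below (K x)" for x by (auto simp: bdd_below_def)
  have self: "pen x \<in> K x" for x
    unfolding K_def by (rule CollectI, rule exI[of _ "[]"]) auto
  show thesis
  proof
    fix x e y assume edge: "(x, e, y) \<in> ts_edges G"
    have "w x - c e \<le> k" if "k \<in> K y" for k
    proof -
      from that obtain p u where p: "is_path G y p u" and k: "k = path_cost c p + pen u"
        by (auto simp: K_def)
      have "path_cost c ((x, e, y) # p) + pen u \<in> K x"
        using edge p unfolding K_def
        by (intro CollectI exI[of _ "(x, e, y) # p"] exI[of _ u]) auto
      then show ?thesis
        unfolding w_def using cInf_lower[OF _ bdd[of x]] by (force simp: k)
    qed
    then have "w x - c e \<le> w y"
      unfolding w_def[THEN fun_cong, of y] using self by (intro cInf_greatest) auto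
    then show "w x \<le> c e + w y" by simp
  next
    show "w (ts_goal G) \<le> 0"
      using cInf_lower[OF self[of "ts_goal G"] bdd] by (simp add: w_def pen_def)
  next
    \<comment> \<open>With \<open>- B\<close> below and the cost of \<open>p0\<close> above, the
      distance is a real number.\<close>
    have "ereal (- B) \<le> goal_distance G c t"
      using nc B by (auto simp: goal_distance_def intro!: INF_greatest)
    then obtain d where d: "goal_distance G c t = ereal d"
      using goal_distance_le[OF p0, of c] by (cases "goal_distance G c t") auto
    have "d \<le> k" if "k \<in> K t" for k
    proof -
      from that obtain p u where p: "is_path G t p u" and k: "k = path_cost c p + pen u"
        by (auto simp: K_def)
      show ?thesis
      proof (cases "u = ts_goal G")
        case True
        then show ?thesis
          using goal_distance_le[of G t p c] p k d by (simp add: pen_def)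
      next
        case False
        then show ?thesis
          using goal_distance_le[OF p0, of c] B[OF p] k d by (simp add: pen_def M_def)
      qed
    qed
    then have "d \<le> w t" unfolding w_def using self by (intro cInf_greatest) auto
    then show "goal_distance G c t \<le> ereal (w t)" by (simp add: d)
  qed
qed


section \<open>States and heuristics of a planning task\<close>

lemma finite_states:
  assumes "planning_task T" shows "finite (states T)"
proof (rule finite_subset)
  show "states T \<subseteq> {m. dom m = variables T \<and> ran m \<subseteq> (\<Union>v\<in>variables T. domain_of T v)}"
    by (auto simp: states_def partial_assignment_def ran_def)
  show "finite {m. dom m = variables T \<and> ran m \<subseteq> (\<Union>v\<in>variables T. domain_of T v)}"
    using assms by (intro finite_set_of_finite_maps) (auto simp: planning_task_def)
qed

lemma result_in_states:
  assumes "planning_task T" "s \<in> states T" "a \<in> operators T"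
  shows "result T a s \<in> states T"
proof -
  have "partial_assignment T (eff T a)" "partial_assignment T s" "dom s = variables T"
    using assms by (auto simp: planning_task_def states_def)
  then show ?thesis
    unfolding states_def partial_assignment_def result_def
    by (auto simp: map_add_Some_iff)
qed

lemma transitions_states:
  assumes "planning_task T" "(r, a, r') \<in> transitions T"
  shows "r \<in> states T" "r' \<in> states T"
  using assms result_in_states by (auto simp: transitions_def)

lemma finite_transitions:
  assumes "planning_task T" shows "finite (transitions T)"
proof (rule finite_subset)
  show "transitions T \<subseteq> states T \<times> operators T \<times> states T"
    using assms by (auto simp: transitions_def intro: result_in_states)
  show "finite (states T \<times> operators T \<times> states T)"
    using finite_states[OF assms] assms by (auto simp: planning_task_def)
qed

lemma finite_abstract_edges:
  assumes "planning_task T" shows "finite (ts_edges (abstract_system T \<alpha>))"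
proof -
  have "ts_edges (abstract_system T \<alpha>) =
      (\<lambda>(r, a, r'). (abs_map \<alpha> r, (r, a, r'), abs_map \<alpha> r')) ` transitions T"
    by (auto simp: abstract_system_def image_iff) (metis (mono_tags, lifting) case_prod_conv)
  then show ?thesis using finite_transitions[OF assms] by simp
qed

lemma abstract_edge_iff:
  "(x, e, y) \<in> ts_edges (abstract_system T \<alpha>) \<longleftrightarrow>
     (\<exists>r a r'. e = (r, a, r') \<and> x = abs_map \<alpha> r \<and> y = abs_map \<alpha> r' \<and> (r, a, r') \<in> transitions T)"
  by (auto simp: abstract_system_def)

lemma ts_goal_abstract_system [simp]:
  "ts_goal (abstract_system T \<alpha>) = abs_map \<alpha> (goal_state T)"
  by (simp add: abstract_system_def)

section \<open>Admissibility as a condition at the goal\<close>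

lemma admissible_goal_le_0:
  assumes "planning_task T" "admissible T h"
  shows "h (goal_state T) \<le> 0"
proof -
  have "h (goal_state T) \<le> hstar T (goal_state T)"
    using assms by (simp add: admissible_def planning_task_def)
  also have "\<dots> \<le> ereal (real (plan_cost T []))"
    unfolding hstar_def by (intro INF_lower) simp
  finally show ?thesis by (simp add: plan_cost_def zero_ereal_def)
qed

text \<open>Consistency adds up along a plan, and a state without plans has \<open>hstar\<close>
  equal to \<infinity>. Hence for consistent heuristics admissibility reduces to a single inequality
  at the goal.\<close>

lemma consistent_imp_admissible:
  assumes T: "planning_task T" and cons: "consistent T h" and goal: "h (goal_state T) \<le> 0"
  shows "admissible T h"
proof -
  have "h s \<le> ereal (real (plan_cost T as))" if "s \<in> states T" "is_plan T s as" for s as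
    using that
  proof (induction as arbitrary: s)
    case Nil
    then show ?case using goal by (simp add: plan_cost_def zero_ereal_def)
  next
    case (Cons a as)
    then have "(s, a, result T a s) \<in> transitions T" by (simp add: transitions_def)
    then have "h s \<le> ereal (real (cost T a)) + h (result T a s)"
      using cons by (auto simp: consistent_def)
    also have "\<dots> \<le> ereal (real (cost T a)) + ereal (real (plan_cost T as))"
      using Cons result_in_states[OF T] by (intro add_left_mono) auto
    finally show ?case by (simp add: plan_cost_def)
  qed
  then show ?thesis by (auto simp: admissible_def hstar_def intro!: INF_greatest)
qed


section \<open>Potentials as sums over abstractions\<close>

text \<open>A state has exactly one feature per abstraction, and disjointness makes these features
  distinct. The infinite sum thus has finite support, which can be reindexed by
  \<open>A\<close>.\<close>

lemma potential_eq_sum: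
  assumes A: "abstraction_collection T A" and s: "s \<in> states T"
  shows "potential A w s = (\<Sum>\<alpha>\<in>A. w (abs_map \<alpha> s))"
proof -
  have fin: "finite A" and mem: "\<And>\<alpha>. \<alpha> \<in> A \<Longrightarrow> abs_map \<alpha> s \<in> abs_states \<alpha>"
    and disj: "disjoint_family_on abs_states A"
    using A s by (auto simp: abstraction_collection_def is_abstraction_def)
  have feat: "has_feature A s (abs_map \<alpha> s)" if "\<alpha> \<in> A" for \<alpha>
    using mem that by (auto simp: has_feature_def)
  have inj: "inj_on (\<lambda>\<alpha>. abs_map \<alpha> s) A"
    using mem disj by (fastforce simp: inj_on_def disjoint_family_on_def)
  have "potential A w s =
      (\<Sum>\<^sub>\<infinity>f\<in>(\<lambda>\<alpha>. abs_map \<alpha> s) ` A. w f * of_bool (has_feature A s f))"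
    unfolding potential_def
    by (rule infsum_cong_neutral) (use mem in \<open>auto simp: features_def has_feature_def\<close>)
  also have "\<dots> = (\<Sum>f\<in>(\<lambda>\<alpha>. abs_map \<alpha> s) ` A. w f * of_bool (has_feature A s f))"
    using fin by simp
  also have "\<dots> = (\<Sum>\<alpha>\<in>A. w (abs_map \<alpha> s))"
    using inj feat by (simp add: sum.reindex)
  finally show ?thesis .
qed

text \<open>Separate weight functions for the abstractions merge into one, because an abstract state
  determines the abstraction it belongs to.\<close>

lemma weights_from_family:
  assumes A: "abstraction_collection T A"
  obtains w where "\<And>s. s \<in> states T \<Longrightarrow> potential A w s = (\<Sum>\<alpha>\<in>A. W \<alpha> (abs_map \<alpha> s))"
proof -
  \<comment> \<open>Outside the features the description is unspecified, but states are only ever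
    mapped to features.\<close>
  define w where "w = (\<lambda>t. W (THE \<alpha>. \<alpha> \<in> A \<and> t \<in> abs_states \<alpha>) t)"
  have w: "w t = W \<alpha> t" if "\<alpha> \<in> A" "t \<in> abs_states \<alpha>" for \<alpha> t
  proof -
    have "(THE \<alpha>. \<alpha> \<in> A \<and> t \<in> abs_states \<alpha>) = \<alpha>"
      using that A by (fastforce simp: abstraction_collection_def disjoint_family_on_def)
    then show ?thesis by (simp add: w_def)
  qed
  show thesis
  proof
    fix s assume s: "s \<in> states T"
    then have "abs_map \<alpha> s \<in> abs_states \<alpha>" if "\<alpha> \<in> A" for \<alpha>
      using A that by (auto simp: abstraction_collection_def is_abstraction_def)
    then show "potential A w s = (\<Sum>\<alpha>\<in>A. W \<alpha> (abs_map \<alpha> s))"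
      by (simp add: potential_eq_sum[OF A s] w)
  qed
qed

section \<open>Maximality as optimality in a linear program\<close>

text \<open>A family \<open>W\<close> meeting the transition and goal constraints is a feasible
  point of the linear program whose optimum at \<open>s\<close> is \<open>h s\<close>. It is applied
  both to perturbed weights of \<open>h\<close> and to shortest-path weights.\<close>

lemma max_potential_heuristic_upper:
  assumes T: "planning_task T" and A: "abstraction_collection T A" and s: "s \<in> states T"
    and h: "max_potential_heuristic T A s h"
    and cons: "\<And>r a r'. (r, a, r') \<in> transitions T \<Longrightarrow>
      (\<Sum>\<alpha>\<in>A. W \<alpha> (abs_map \<alpha> r)) \<le> real (cost T a) + (\<Sum>\<alpha>\<in>A. W \<alpha> (abs_map \<alpha> r'))"
    and goal: "(\<Sum>\<alpha>\<in>A. W \<alpha> (abs_map \<alpha> (goal_state T))) \<le> 0"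
  shows "ereal (\<Sum>\<alpha>\<in>A. W \<alpha> (abs_map \<alpha> s)) \<le> h s"
proof -
  obtain w where w: "\<And>s. s \<in> states T \<Longrightarrow> potential A w s = (\<Sum>\<alpha>\<in>A. W \<alpha> (abs_map \<alpha> s))"
    using weights_from_family[OF A] by blast
  define h' where "h' = (\<lambda>s. ereal (potential A w s))"
  have "consistent T h'"
    using cons transitions_states[OF T] by (auto simp: consistent_def h'_def w)
  moreover have "h' (goal_state T) \<le> 0"
    using goal T by (simp add: h'_def w planning_task_def)
  ultimately have "admissible T h'"
    using consistent_imp_admissible[OF T] by blast
  moreover have "potential_heuristic T A h'"
    by (auto simp: potential_heuristic_def h'_def)
  ultimately have "h' s \<le> h s"
    using h \<open>consistent T h'\<close> by (auto simp: max_potential_heuristic_def)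
  then show ?thesis by (simp add: h'_def w s)
qed

lemma max_potential_heuristic_weights:
  assumes T: "planning_task T" and A: "abstraction_collection T A"
    and h: "max_potential_heuristic T A s h"
  obtains w where "\<And>r. r \<in> states T \<Longrightarrow> h r = ereal (\<Sum>\<alpha>\<in>A. w (abs_map \<alpha> r))"
    and "\<And>r a r'. (r, a, r') \<in> transitions T \<Longrightarrow>
      (\<Sum>\<alpha>\<in>A. w (abs_map \<alpha> r)) \<le> real (cost T a) + (\<Sum>\<alpha>\<in>A. w (abs_map \<alpha> r'))"
    and "(\<Sum>\<alpha>\<in>A. w (abs_map \<alpha> (goal_state T))) \<le> 0"
proof -
  obtain w where "\<And>r. r \<in> states T \<Longrightarrow> h r = ereal (potential A w r)"
    using h by (auto simp: max_potential_heuristic_def potential_heuristic_def)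
  then have w: "\<And>r. r \<in> states T \<Longrightarrow> h r = ereal (\<Sum>\<alpha>\<in>A. w (abs_map \<alpha> r))"
    by (simp add: potential_eq_sum[OF A])
  show thesis
  proof
    show "\<And>r. r \<in> states T \<Longrightarrow> h r = ereal (\<Sum>\<alpha>\<in>A. w (abs_map \<alpha> r))" by (fact w)
  next
    fix r a r' assume tr: "(r, a, r') \<in> transitions T"
    then have "h r \<le> ereal (real (cost T a)) + h r'"
      using h by (auto simp: max_potential_heuristic_def consistent_def)
    then show "(\<Sum>\<alpha>\<in>A. w (abs_map \<alpha> r)) \<le> real (cost T a) + (\<Sum>\<alpha>\<in>A. w (abs_map \<alpha> r'))"
      using transitions_states[OF T tr] by (simp add: w)
  next
    have "goal_state T \<in> states T" using T by (simp add: planning_task_def)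
    moreover have "h (goal_state T) \<le> 0"
      using h admissible_goal_le_0[OF T] by (simp add: max_potential_heuristic_def)
    ultimately show "(\<Sum>\<alpha>\<in>A. w (abs_map \<alpha> (goal_state T))) \<le> 0" by (simp add: w)
  qed
qed

text \<open>Otherwise all weights of dead abstract states of \<open>\<beta>\<close> could be raised
  by 1, increasing the value at \<open>s\<close>. Reachability keeps abstraction heuristics below
  \<infinity> under every cost partitioning.\<close>

lemma max_potential_heuristic_reachable:
  assumes T: "planning_task T" and A: "abstraction_collection T A" and s: "s \<in> states T"
    and h: "max_potential_heuristic T A s h" and \<beta>: "\<beta> \<in> A"
  shows "\<exists>p. is_path (abstract_system T \<beta>) (abs_map \<beta> s) p (abs_map \<beta> (goal_state T))"
proof -
  let ?G = "abstract_system T \<beta>" and ?g = "abs_map \<beta> (goal_state T)"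
  have fin: "finite A" using A by (simp add: abstraction_collection_def)
  obtain w where w: "\<And>r. r \<in> states T \<Longrightarrow> h r = ereal (\<Sum>\<alpha>\<in>A. w (abs_map \<alpha> r))"
    and cons: "\<And>r a r'. (r, a, r') \<in> transitions T \<Longrightarrow>
      (\<Sum>\<alpha>\<in>A. w (abs_map \<alpha> r)) \<le> real (cost T a) + (\<Sum>\<alpha>\<in>A. w (abs_map \<alpha> r'))"
    and goal: "(\<Sum>\<alpha>\<in>A. w (abs_map \<alpha> (goal_state T))) \<le> 0"
    using max_potential_heuristic_weights[OF T A h] by blast
  define dead :: "_ \<Rightarrow> real" where "dead = (\<lambda>t. of_bool (\<not> (\<exists>p. is_path ?G t p ?g)))"
  define W where "W = (\<lambda>\<alpha> t. w t + (if \<alpha> = \<beta> then dead t else 0))"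
  have W: "(\<Sum>\<alpha>\<in>A. W \<alpha> (abs_map \<alpha> r)) = (\<Sum>\<alpha>\<in>A. w (abs_map \<alpha> r)) + dead (abs_map \<beta> r)" for r
  proof -
    have "(\<Sum>\<alpha>\<in>A. if \<alpha> = \<beta> then dead (abs_map \<alpha> r) else 0) = dead (abs_map \<beta> r)"
      using fin \<beta> by simp
    then show ?thesis by (simp add: W_def sum.distrib)
  qed
  \<comment> \<open>A transition into an abstract state that reaches the goal also starts in one, so
    the perturbation raises the right-hand side of each constraint at least as much as the
    left.\<close>
  have mono: "dead (abs_map \<beta> r) \<le> dead (abs_map \<beta> r')" if "(r, a, r') \<in> transitions T" for r a r'
  proof -
    have "is_path ?G (abs_map \<beta> r) ((abs_map \<beta> r, (r, a, r'), abs_map \<beta> r') # p) ?g"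
      if "is_path ?G (abs_map \<beta> r') p ?g" for p
      using that \<open>(r, a, r') \<in> transitions T\<close> by (simp add: abstract_edge_iff)
    then show ?thesis unfolding dead_def by (auto simp del: is_path.simps)
  qed
  have "is_path ?G ?g [] ?g" by simp
  then have "dead ?g = 0" unfolding dead_def by (auto simp del: is_path.simps)
  moreover have "(\<Sum>\<alpha>\<in>A. W \<alpha> (abs_map \<alpha> r)) \<le> real (cost T a) + (\<Sum>\<alpha>\<in>A. W \<alpha> (abs_map \<alpha> r'))"
    if "(r, a, r') \<in> transitions T" for r a r'
    unfolding W using cons[OF that] mono[OF that] by linarith
  ultimately have "ereal (\<Sum>\<alpha>\<in>A. W \<alpha> (abs_map \<alpha> s)) \<le> h s"
    using goal by (intro max_potential_heuristic_upper[OF T A s h]) (simp_all add: W)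
  then have "dead (abs_map \<beta> s) \<le> 0" by (simp add: w s W)
  then show ?thesis by (simp add: dead_def of_bool_def split: if_splits)
qed


section \<open>Potentials and cost partitionings\<close>

lemma h_partitioning_le_max_potential:
  assumes T: "planning_task T" and A: "abstraction_collection T A" and s: "s \<in> states T"
    and h: "max_potential_heuristic T A s h" and P: "P \<in> cost_partitionings T A"
  shows "h_partitioning T A P s \<le> h s"
proof -
  have fin: "finite A" using A by (simp add: abstraction_collection_def)
  have reach: "\<exists>p. is_path (abstract_system T \<alpha>) (abs_map \<alpha> s) p (ts_goal (abstract_system T \<alpha>))"
    if "\<alpha> \<in> A" for \<alpha>
    using max_potential_heuristic_reachable[OF T A s h that] by simp
  show ?thesis
  proof (cases "\<exists>\<beta>\<in>A. has_negative_cycle (abstract_system T \<beta>) (P \<beta>)")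
    case True
    then obtain \<beta> where \<beta>: "\<beta> \<in> A" "has_negative_cycle (abstract_system T \<beta>) (P \<beta>)" by blast
    have "abstraction_heuristic T \<beta> (P \<beta>) s = -\<infinity>"
      using \<beta> reach[OF \<beta>(1)] by (simp add: abstraction_heuristic_def goal_distance_def)
    \<comment> \<open>In \<open>ereal\<close>, \<infinity> plus \<open>-\<infinity>\<close> is
      \<infinity>, so infinite summands must be excluded before the one at \<open>\<beta>\<close>
      can dominate.\<close>
    moreover have "abstraction_heuristic T \<alpha> (P \<alpha>) s \<noteq> \<infinity>" if "\<alpha> \<in> A" for \<alpha>
    proof -
      obtain p where "is_path (abstract_system T \<alpha>) (abs_map \<alpha> s) p (ts_goal (abstract_system T \<alpha>))"
        using reach[OF \<open>\<alpha> \<in> A\<close>] by blast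
      from goal_distance_le[OF this, of "P \<alpha>"] show ?thesis
        by (auto simp: abstraction_heuristic_def)
    qed
    then have "(\<Sum>\<alpha>\<in>A - {\<beta>}. abstraction_heuristic T \<alpha> (P \<alpha>) s) \<noteq> \<infinity>"
      by (auto simp: sum_Pinfty)
    ultimately have "h_partitioning T A P s = -\<infinity>"
      using fin \<beta>(1) by (simp add: h_partitioning_def sum.remove)
    then show ?thesis by simp
  next
    case False
    have "\<forall>\<alpha>\<in>A. \<exists>w.
        (\<forall>x e y. (x, e, y) \<in> ts_edges (abstract_system T \<alpha>) \<longrightarrow> w x \<le> P \<alpha> e + w y) \<and>
        w (abs_map \<alpha> (goal_state T)) \<le> 0 \<and>
        abstraction_heuristic T \<alpha> (P \<alpha>) s \<le> ereal (w (abs_map \<alpha> s))"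
      (is "\<forall>\<alpha>\<in>A. \<exists>w. ?weights \<alpha> w")
    proof
      fix \<alpha> assume \<alpha>: "\<alpha> \<in> A"
      obtain p0 where p0:
          "is_path (abstract_system T \<alpha>) (abs_map \<alpha> s) p0 (ts_goal (abstract_system T \<alpha>))"
        using reach[OF \<alpha>] by blast
      \<comment> \<open>Negative cycles are absent from the whole abstract system, not just from the
        part relevant to \<open>s\<close>; this is why the weights obey a constraint on every edge,
        as consistency demands.\<close>
      have nc: "\<not> has_negative_cycle (abstract_system T \<alpha>) (P \<alpha>)"
        using False \<alpha> by blast
      obtain w where "\<And>x e y. (x, e, y) \<in> ts_edges (abstract_system T \<alpha>) \<Longrightarrow> w x \<le> P \<alpha> e + w y"
        and "w (ts_goal (abstract_system T \<alpha>)) \<le> 0"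
        and "goal_distance (abstract_system T \<alpha>) (P \<alpha>) (abs_map \<alpha> s) \<le> ereal (w (abs_map \<alpha> s))"
        using shortest_path_weights[OF finite_abstract_edges[OF T] nc p0] by blast
      then have "?weights \<alpha> w" by (simp add: abstraction_heuristic_def)
      then show "\<exists>w. ?weights \<alpha> w" by (rule exI[of _ w])
    qed
    from bchoice[OF this] obtain W where W: "\<forall>\<alpha>\<in>A. ?weights \<alpha> (W \<alpha>)" ..
    have edge: "W \<alpha> x \<le> P \<alpha> e + W \<alpha> y"
      if "\<alpha> \<in> A" "(x, e, y) \<in> ts_edges (abstract_system T \<alpha>)" for \<alpha> x e y
      using W that by blast
    have goal: "W \<alpha> (abs_map \<alpha> (goal_state T)) \<le> 0"
      and val: "abstraction_heuristic T \<alpha> (P \<alpha>) s \<le> ereal (W \<alpha> (abs_map \<alpha> s))"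
      if "\<alpha> \<in> A" for \<alpha>
      using W that by blast+
    have "h_partitioning T A P s \<le> (\<Sum>\<alpha>\<in>A. ereal (W \<alpha> (abs_map \<alpha> s)))"
      unfolding h_partitioning_def by (intro sum_mono val)
    also have "\<dots> = ereal (\<Sum>\<alpha>\<in>A. W \<alpha> (abs_map \<alpha> s))" by simp
    also have "\<dots> \<le> h s"
    proof (rule max_potential_heuristic_upper[OF T A s h])
      fix r a r' assume tr: "(r, a, r') \<in> transitions T"
      \<comment> \<open>One concrete transition induces an edge in each abstraction; adding these
        edge constraints leaves a total cost that the partitioning bounds by the operator
        cost.\<close>
      have "(\<Sum>\<alpha>\<in>A. W \<alpha> (abs_map \<alpha> r)) \<le> (\<Sum>\<alpha>\<in>A. P \<alpha> (r, a, r') + W \<alpha> (abs_map \<alpha> r'))"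
        using tr by (intro sum_mono edge) (auto simp: abstract_edge_iff)
      moreover have "(\<Sum>\<alpha>\<in>A. P \<alpha> (r, a, r')) \<le> real (cost T a)"
        using P tr by (auto simp: cost_partitionings_def)
      ultimately show "(\<Sum>\<alpha>\<in>A. W \<alpha> (abs_map \<alpha> r)) \<le>
          real (cost T a) + (\<Sum>\<alpha>\<in>A. W \<alpha> (abs_map \<alpha> r'))"
        by (simp add: sum.distrib)
    qed (intro sum_nonpos goal)
    finally show ?thesis .
  qed
qed

text \<open>For weight differences as costs, the partitioning condition is exactly consistency. The
  differences vary with the transition, not only with its operator, and may be negative.\<close>

lemma max_potential_le_h_partitioning:
  fixes T :: "('v, 'd, 'o) task" and A :: "('v, 'd, 't) abstraction set"
  assumes T: "planning_task T" and A: "abstraction_collection T A" and s: "s \<in> states T"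
    and h: "max_potential_heuristic T A s h"
  obtains P where "P \<in> cost_partitionings T A" and "h s \<le> h_partitioning T A P s"
proof -
  obtain w where w: "\<And>r. r \<in> states T \<Longrightarrow> h r = ereal (\<Sum>\<alpha>\<in>A. w (abs_map \<alpha> r))"
    and cons: "\<And>r a r'. (r, a, r') \<in> transitions T \<Longrightarrow>
      (\<Sum>\<alpha>\<in>A. w (abs_map \<alpha> r)) \<le> real (cost T a) + (\<Sum>\<alpha>\<in>A. w (abs_map \<alpha> r'))"
    and goal: "(\<Sum>\<alpha>\<in>A. w (abs_map \<alpha> (goal_state T))) \<le> 0"
    using max_potential_heuristic_weights[OF T A h] by blast
  define P :: "('v, 'd, 't) abstraction \<Rightarrow> ('v, 'd, 'o) transition \<Rightarrow> real"
    where "P = (\<lambda>\<alpha> (r, a, r'). w (abs_map \<alpha> r) - w (abs_map \<alpha> r'))"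
  show thesis
  proof
    show "P \<in> cost_partitionings T A"
      using cons by (force simp: cost_partitionings_def P_def sum_subtractf)
    \<comment> \<open>Telescoping measures weights relative to the goal; subtracting the goal
      potential loses nothing because it is nonpositive.\<close>
    have "h s \<le> ereal ((\<Sum>\<alpha>\<in>A. w (abs_map \<alpha> s)) - (\<Sum>\<alpha>\<in>A. w (abs_map \<alpha> (goal_state T))))"
      using w[OF s] goal by simp
    also have "\<dots> = (\<Sum>\<alpha>\<in>A. ereal (w (abs_map \<alpha> s) - w (abs_map \<alpha> (goal_state T))))"
      by (simp add: sum_subtractf)
    also have "\<dots> \<le> h_partitioning T A P s"
      unfolding h_partitioning_def abstraction_heuristic_def ts_goal_abstract_system[symmetric]
      by (intro sum_mono goal_distance_telescope) (auto simp: P_def abstract_edge_iff)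
    finally show "h s \<le> h_partitioning T A P s" .
  qed
qed

theorem theorem7:
  fixes T :: "('v, 'd, 'o) task"
    and A :: "('v, 'd, 't) abstraction set"
    and s :: "('v, 'd) assignment"
    and h :: "('v, 'd) heuristic"
  assumes "planning_task T"
    and "abstraction_collection T A"
    and "s \<in> states T"
    and "max_potential_heuristic T A s h"
  shows "h s = h_TCP T A s \<and>
    (\<exists>P\<in>cost_partitionings T A. h_partitioning T A P s = h_TCP T A s)"
proof -
  \<comment> \<open>The same \<open>P\<close> closes the chain of inequalities and attains the
    supremum, so the optimum is a genuine maximum.\<close>
  obtain P where P: "P \<in> cost_partitionings T A" "h s \<le> h_partitioning T A P s"
    using max_potential_le_h_partitioning[OF assms] .
  have le: "h_TCP T A s \<le> h s"
    unfolding h_TCP_def by (intro SUP_least h_partitioning_le_max_potential[OF assms])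
  have "h_partitioning T A P s \<le> h_TCP T A s"
    unfolding h_TCP_def by (intro SUP_upper P(1))
  with P le show ?thesis by (metis order.antisym order.trans)
qed

end
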